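(* Let $\mathcal X=(x_n)_{n\in\mathbb N}$ be a fundamental minimal system for $\mathbb X$ with dual system $\mathcal X^*$, let $(d_j)_{j\in\mathbb N}$ be an unbounded sequence of positive integers, and let $(t_j)_{j\in\mathbb N}$ be a sequence with $0<t_j<1$ for all $j$. Suppose that for every $f\in\mathbb X$ there is a sequence $(A_{f,j})_{j\in\mathbb N}$ with $A_{f,j}\in\mathcal G(f,d_j,t_j)$ for all $j$ such that the sequence $(P_{A_{f,j}}(f))_{j\in\mathbb N}$ is bounded in $\mathbb X$. Then $\langle\mathcal X^*\rangle$ is a norming subspace of $\mathbb X^*$.
   Context: Throughout, $\mathbb X$ is an infinite-dimensional separable Banach space over $\mathbb F\in\{\mathbb R,\mathbb C\}$. A (fundamental minimal) system for $\mathbb X$ is a sequence $\mathcal X=(x_n)_{n\in\mathbb N}\subset\mathbb X$ whose linear span $\langle\mathcal X\rangle$ is dense in $\mathbb X$ and for which there is a sequence $\mathcal X^*=(x_n^* )_{n\in\mathbb N}\subset\mathbb X^*$ with $x_n^*(x_k)=\delta_{nk}$ for all $n,k$; $\mathcal X^*$ is called the dual system. For finite $A\subset\mathbb N$ and $f\in\mathbb X$, $P_A(f)=\sum_{n\in A}x_n^*(f)x_n$. For $0<t\le1$ and $f\in\mathbb X$, a set $A\subset\mathbb N$ is a $t$-greedy set of $f$ if $|x_n^*(f)|\ge t|x_k^*(f)|$ for all $n\in A$, $k\notin A$; $\mathcal G(f,m,t)$ denotes the set of $t$-greedy sets of $f$ of cardinality $m$. A subspace $\mathbb Z\subset\mathbb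 X^*$ is norming if there is $c\in(0,1]$ with $c\|f\|\le\sup\{|f^*(f)|: f^*\in\mathbb Z,\ \|f^*\|=1\}$ for all $f\in\mathbb X$. *)

theory Defs
  imports "HOL-Analysis.Analysis"
begin

text \<open>
  The Banach space X over F \<in> {R, C} is modelled as a real Banach space (type class banach)
  together with a set of scalars F :: complex set, which is either the real line or all of C,
  and a scalar multiplication smul by elements of F compatible with the real structure.
\<close>

definition scalar_field :: "complex set \<Rightarrow> bool" where
  "scalar_field F \<longleftrightarrow> F = range complex_of_real \<or> F = UNIV"

definition scalar_structure :: "complex set \<Rightarrow> (complex \<Rightarrow> 'a::banach \<Rightarrow> 'a) \<Rightarrow> bool" where
  "scalar_structure F smul \<longleftrightarrow> scalar_field F \<and>
     (\<forall>r x. smul (complex_of_real r) x = r *\<^sub>R x) \<and>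
     (\<forall>c\<in>F. \<forall>x y. smul c (x + y) = smul c x + smul c y) \<and>
     (\<forall>c\<in>F. \<forall>d\<in>F. \<forall>x. smul (c + d) x = smul c x + smul d x) \<and>
     (\<forall>c\<in>F. \<forall>d\<in>F. \<forall>x. smul (c * d) x = smul c (smul d x)) \<and>
     (\<forall>c\<in>F. \<forall>x. norm (smul c x) = cmod c * norm x)"

definition infinite_dimensional_separable :: "'a::banach itself \<Rightarrow> bool" where
  "infinite_dimensional_separable _ \<longleftrightarrow>
     \<not> (\<exists>B::'a set. finite B \<and> span B = UNIV) \<and>
     (\<exists>D::'a set. countable D \<and> closure D = UNIV)"

definition Fspan :: "complex set \<Rightarrow> (complex \<Rightarrow> 'a::banach \<Rightarrow> 'a) \<Rightarrow> 'a set \<Rightarrow> 'a set" where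
  "Fspan F smul S = {v. \<exists>(n::nat) c s. (\<forall>i<n. c i \<in> F \<and> s i \<in> S) \<and> v = (\<Sum>i<n. smul (c i) (s i))}"

definition Fdual :: "complex set \<Rightarrow> (complex \<Rightarrow> 'a::banach \<Rightarrow> 'a) \<Rightarrow> ('a \<Rightarrow> complex) set" where
  "Fdual F smul = {g. (\<forall>x. g x \<in> F) \<and> (\<forall>x y. g (x + y) = g x + g y) \<and>
      (\<forall>c\<in>F. \<forall>x. g (smul c x) = c * g x) \<and> (\<exists>K. \<forall>x. cmod (g x) \<le> K * norm x)}"

definition fundamental_minimal_system ::
  "complex set \<Rightarrow> (complex \<Rightarrow> 'a::banach \<Rightarrow> 'a) \<Rightarrow> (nat \<Rightarrow> 'a) \<Rightarrow> (nat \<Rightarrow> 'a \<Rightarrow> complex) \<Rightarrow> bool" where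
  "fundamental_minimal_system F smul x xs \<longleftrightarrow>
     closure (Fspan F smul (range x)) = UNIV \<and>
     (\<forall>n. xs n \<in> Fdual F smul) \<and>
     (\<forall>n k. xs n (x k) = (if n = k then 1 else 0))"

definition proj :: "(complex \<Rightarrow> 'a::banach \<Rightarrow> 'a) \<Rightarrow> (nat \<Rightarrow> 'a) \<Rightarrow> (nat \<Rightarrow> 'a \<Rightarrow> complex)
    \<Rightarrow> nat set \<Rightarrow> 'a \<Rightarrow> 'a" where
  "proj smul x xs A f = (\<Sum>n\<in>A. smul (xs n f) (x n))"

definition is_greedy_set :: "(nat \<Rightarrow> 'a \<Rightarrow> complex) \<Rightarrow> 'a \<Rightarrow> real \<Rightarrow> nat set \<Rightarrow> bool" where
  "is_greedy_set xs f t A \<longleftrightarrow> (\<forall>n\<in>A. \<forall>k. k \<notin> A \<longrightarrow> cmod (xs n f) \<ge> t * cmod (xs k f))"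

definition greedy_sets :: "(nat \<Rightarrow> 'a \<Rightarrow> complex) \<Rightarrow> 'a \<Rightarrow> nat \<Rightarrow> real \<Rightarrow> nat set set" where
  "greedy_sets xs f m t = {A. finite A \<and> card A = m \<and> is_greedy_set xs f t A}"

definition dual_span :: "complex set \<Rightarrow> (nat \<Rightarrow> 'a \<Rightarrow> complex) \<Rightarrow> ('a \<Rightarrow> complex) set" where
  "dual_span F xs = {g. \<exists>A c. finite A \<and> (\<forall>n\<in>A. c n \<in> F) \<and> g = (\<lambda>v. \<Sum>n\<in>A. c n * xs n v)}"

definition norming :: "('a::banach \<Rightarrow> complex) set \<Rightarrow> bool" where
  "norming Z \<longleftrightarrow> (\<exists>c. 0 < c \<and> c \<le> 1 \<and>
      (\<forall>f. c * norm f \<le> Sup {cmod (g f) | g. g \<in> Z \<and> onorm g = 1}))"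

end

theory Submission
  imports Defs
begin

text \<open>
  By Baire, on some ball around \<open>f0\<close> the greedy sums are bounded by one constant \<open>C\<close> on a dense
  subset, and the \<open>x\<^sub>n\<^sup>*\<close> are uniformly bounded. If the span of the dual system is not norming,
  then by a finite-dimensional Hahn-Banach argument there is \<open>f\<close> of large norm whose distance to
  \<open>\<Inter>\<^sub>i\<^sub><\<^sub>N ker x\<^sub>i\<^sup>*\<close> is small for every \<open>N\<close> simultaneously. Approximate \<open>f0 + f\<close> by a vector
  \<open>y\<close> whose support is exactly the first \<open>d\<^sub>j\<close> indices, and only then (so that \<open>t\<^sub>j\<close> is known)
  approximate \<open>f\<close> by some \<open>u\<close> supported beyond them. Averaging many disjointly supported such \<open>u\<close>
  makes the coordinates of \<open>u\<close> negligible against those of \<open>y\<close>. Near \<open>y - u\<close>, which lies in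
  the ball, the only \<open>t\<^sub>j\<close>-greedy set of size \<open>d\<^sub>j\<close> is the support of \<open>y\<close>, so the greedy sum is
  close to \<open>y\<close>, whose norm exceeds \<open>C\<close>.
\<close>

subsection \<open>Baire category and dominated functionals\<close>

text \<open>Baire category: were all these closures nowhere dense, their union, the whole space,
  would have empty interior. The sets themselves need not be closed, so the result is only density
  in a ball.\<close>

lemma countable_cover_closure_ball:
  fixes X :: "nat \<Rightarrow> 'a::banach set"
  assumes "(\<Union>n. X n) = UNIV"
  obtains n f \<delta> where "0 < \<delta>" "ball f \<delta> \<subseteq> closure (X n)"
proof -
  have "\<exists>n. interior (closure (X n)) \<noteq> {}"
  proof (rule ccontr)
    assume "\<not> ?thesis"
    then have "euclidean interior_of \<Union>(range (\<lambda>n. closure (X n))) = {}"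
      by (intro Baire_category_alt disjI1 completely_metrizable_space_euclidean) auto
    moreover have "\<Union>(range (\<lambda>n. closure (X n))) = UNIV"
      using assms closure_subset by blast
    ultimately show False by simp
  qed
  then obtain n f where "f \<in> interior (closure (X n))" by auto
  then show ?thesis using that by (auto simp: mem_interior)
qed

section \<open>Sublinear functionals and their reduction to linear ones\<close>

text \<open>Scaling is an inequality, which is easier to verify for newly built functionals;
  \<open>sublinear_scaleR\<close> recovers equality by scaling back with the inverse.\<close>

definition sublinear :: "('a::real_vector \<Rightarrow> real) \<Rightarrow> bool" where
  "sublinear p \<longleftrightarrow> (\<forall>u v. p (u + v) \<le> p u + p v) \<and> (\<forall>r v. 0 \<le> r \<longrightarrow> p (r *\<^sub>R v) \<le> r * p v)"

lemma sublinear_zero: "sublinear p \<Longrightarrow> p 0 = 0"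
proof -
  assume p: "sublinear p"
  have "p (0 *\<^sub>R 0) \<le> 0 * p 0" using p unfolding sublinear_def by blast
  moreover have "p (0 + 0) \<le> p 0 + p 0" using p unfolding sublinear_def by blast
  ultimately show ?thesis by simp
qed

lemma sublinear_scaleR:
  assumes p: "sublinear p" and "0 \<le> r"
  shows "p (r *\<^sub>R v) = r * p v"
proof (cases "r = 0")
  case False
  have "p (inverse r *\<^sub>R (r *\<^sub>R v)) \<le> inverse r * p (r *\<^sub>R v)"
    using p \<open>0 \<le> r\<close> unfolding sublinear_def by (meson inverse_nonnegative_iff_nonnegative)
  then have "r * p v \<le> p (r *\<^sub>R v)"
    using False \<open>0 \<le> r\<close> by (simp add: field_simps)
  moreover have "p (r *\<^sub>R v) \<le> r * p v"
    using p \<open>0 \<le> r\<close> unfolding sublinear_def by blast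
  ultimately show ?thesis by simp
qed (simp add: sublinear_zero[OF p])

lemma sublinear_add_le: "sublinear p \<Longrightarrow> p (u + v) \<le> p u + p v"
  unfolding sublinear_def by blast

lemma sublinear_uminus_ge: "sublinear p \<Longrightarrow> - p v \<le> p (- v)"
  using sublinear_add_le[of p v "- v"] sublinear_zero[of p] by simp

text \<open>
  Hahn-Banach without partial functionals: a sublinear \<open>p\<close> is pushed down until it is odd, hence
  linear, one direction \<open>z\<close> at a time, by \<open>v \<mapsto> inf\<^sub>s\<^sub>\<ge>\<^sub>0 (p (v + s z) - s p z)\<close>.
\<close>

lemma sublinear_reduce:
  assumes p: "sublinear p"
  obtains q where "sublinear q" "\<And>v. q v \<le> p v" "q (- z) = - p z"
proof -
  define q where "q v = (INF s\<in>{0..}. p (v + s *\<^sub>R z) - s * p z)" for v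
  \<comment> \<open>Subadditivity on \<open>s *\<^sub>R z = - v + (v + s *\<^sub>R z)\<close> keeps
    the infimum finite.\<close>
  have lower: "- p (- v) \<le> p (v + s *\<^sub>R z) - s * p z" if "0 \<le> s" for v s
    using sublinear_add_le[OF p, of "- v" "v + s *\<^sub>R z"] sublinear_scaleR[OF p that, of z] by simp
  have bdd: "bdd_below ((\<lambda>s. p (v + s *\<^sub>R z) - s * p z) ` {0..})" for v
    using lower by (intro bdd_belowI2[where m = "- p (- v)"]) auto
  have q_le: "q v \<le> p (v + s *\<^sub>R z) - s * p z" if "0 \<le> s" for v s
    unfolding q_def using that by (intro cINF_lower bdd) auto
  have q_ge: "a \<le> q v" if "\<And>s. 0 \<le> s \<Longrightarrow> a \<le> p (v + s *\<^sub>R z) - s * p z" for a v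
    unfolding q_def using that by (intro cINF_greatest) auto
  have add: "q (u + v) \<le> q u + q v" for u v
  proof -
    \<comment> \<open>The parameters for \<open>u\<close> and \<open>v\<close> merge into
      \<open>s + r\<close>; afterwards the infimum is taken over \<open>s\<close> first and then
      over \<open>r\<close>.\<close>
    have "q (u + v) - (p (v + r *\<^sub>R z) - r * p z) \<le> p (u + s *\<^sub>R z) - s * p z"
      if "0 \<le> s" "0 \<le> r" for s r
    proof -
      have "q (u + v) \<le> p (u + v + (s + r) *\<^sub>R z) - (s + r) * p z"
        using that by (intro q_le) simp
      also have "u + v + (s + r) *\<^sub>R z = (u + s *\<^sub>R z) + (v + r *\<^sub>R z)"
        by (simp add: algebra_simps)
      finally show ?thesis
        using sublinear_add_le[OF p, of "u + s *\<^sub>R z" "v + r *\<^sub>R z"] by (simp add: algebra_simps)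
    qed
    then have "q (u + v) - (p (v + r *\<^sub>R z) - r * p z) \<le> q u" if "0 \<le> r" for r
      using that by (intro q_ge)
    then have "q (u + v) - q u \<le> p (v + r *\<^sub>R z) - r * p z" if "0 \<le> r" for r
      using that by (simp add: algebra_simps)
    then have "q (u + v) - q u \<le> q v" by (intro q_ge)
    then show ?thesis by simp
  qed
  have scale: "q (r *\<^sub>R v) \<le> r * q v" if "0 \<le> r" for r v
  proof (cases "r = 0")
    case True
    then show ?thesis using q_le[of 0 0] sublinear_zero[OF p] by simp
  next
    case False
    have "q (r *\<^sub>R v) / r \<le> p (v + s *\<^sub>R z) - s * p z" if "0 \<le> s" for s
    proof -
      have "q (r *\<^sub>R v) \<le> p (r *\<^sub>R v + (r * s) *\<^sub>R z) - (r * s) * p z"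
        using \<open>0 \<le> r\<close> that by (intro q_le) simp
      also have "r *\<^sub>R v + (r * s) *\<^sub>R z = r *\<^sub>R (v + s *\<^sub>R z)"
        by (simp add: algebra_simps)
      finally show ?thesis
        using sublinear_scaleR[OF p \<open>0 \<le> r\<close>, of "v + s *\<^sub>R z"] False \<open>0 \<le> r\<close>
        by (simp add: field_simps)
    qed
    then have "q (r *\<^sub>R v) / r \<le> q v" by (intro q_ge)
    then show ?thesis using False \<open>0 \<le> r\<close> by (simp add: field_simps)
  qed
  have q: "sublinear q" unfolding sublinear_def using add scale by blast
  have le: "q v \<le> p v" for v using q_le[of 0 v] by simp
  have "q (- z) \<le> - p z" using q_le[of 1 "- z"] sublinear_zero[OF p] by simp
  moreover have "- p z \<le> q (- z)"
    using sublinear_uminus_ge[OF q, of z] le[of z] by linarith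
  ultimately show ?thesis using that[OF q le] by simp
qed

text \<open>Squeeze: \<open>- q z \<le> q (- z) \<le> p (- z) = - p z \<le> - q z\<close>. Oddness
  once gained thus survives every later reduction.\<close>

lemma sublinear_odd_le:
  assumes "sublinear q" "\<And>v. q v \<le> p v" "p (- z) = - p z"
  shows "q (- z) = - q z"
  using assms(2)[of z] assms(2)[of "- z"] assms(3) sublinear_uminus_ge[OF assms(1), of z] by linarith

lemma sublinear_reduce_finite:
  assumes "finite S" "sublinear p"
  shows "\<exists>q. sublinear q \<and> (\<forall>v. q v \<le> p v) \<and> (\<forall>z\<in>S. q (- z) = - q z)"
  using assms(1)
proof (induction S)
  case empty
  then show ?case using assms(2) by auto
next
  case (insert z S)
  then obtain q where q: "sublinear q" "\<And>v. q v \<le> p v" "\<And>z. z \<in> S \<Longrightarrow> q (- z) = - q z" by auto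
  obtain q' where q': "sublinear q'" "\<And>v. q' v \<le> q v" "q' (- z) = - q z"
    using sublinear_reduce[OF q(1)] by blast
  have "q' (- z) = - q' z"
    using q'(2)[of z] q'(3) sublinear_uminus_ge[OF q'(1), of z] by linarith
  then show ?case
    using q q' sublinear_odd_le[OF q'(1,2)] by (intro exI[of _ q']) (auto intro: order_trans)
qed

text \<open>Allows oddness to be checked on a spanning set only.\<close>

lemma sublinear_odd_subspace:
  assumes p: "sublinear p"
  shows "subspace {v. p (- v) = - p v}"
proof (rule subspaceI; clarsimp)
  show "p 0 = 0" by (rule sublinear_zero[OF p])
next
  fix u v assume uv: "p (- u) = - p u" "p (- v) = - p v"
  have "p (- u - v) \<le> - p u - p v"
    using sublinear_add_le[OF p, of "- u" "- v"] uv by simp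
  moreover have "p (u + v) \<le> p u + p v" by (rule sublinear_add_le[OF p])
  moreover have "- p (u + v) \<le> p (- u - v)"
    using sublinear_uminus_ge[OF p, of "u + v"] by simp
  ultimately show "p (- u - v) = - p (u + v)" by linarith
next
  fix c v assume v: "p (- v) = - p v"
  show "p (- (c *\<^sub>R v)) = - p (c *\<^sub>R v)"
  proof (cases "0 \<le> c")
    case True
    then show ?thesis using sublinear_scaleR[OF p True, of v] sublinear_scaleR[OF p True, of "- v"] v by simp
  next
    case False
    then have "0 \<le> - c" by simp
    from sublinear_scaleR[OF p this, of v] sublinear_scaleR[OF p this, of "- v"] v
    show ?thesis by simp
  qed
qed

text \<open>For an odd functional, subadditivity at the negated vectors is superadditivity at the
  original ones.\<close>

lemma sublinear_odd_linear:
  assumes p: "sublinear p" and odd: "\<And>v. p (- v) = - p v"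
  shows "linear p"
proof (rule linearI)
  fix u v
  show "p (u + v) = p u + p v"
    using sublinear_add_le[OF p, of u v] sublinear_add_le[OF p, of "- u" "- v"] odd[of "u + v"]
      odd[of u] odd[of v] by simp
next
  fix c v
  show "p (c *\<^sub>R v) = c *\<^sub>R p v"
  proof (cases "0 \<le> c")
    case False
    then have "p (- (c *\<^sub>R v)) = - c * p v"
      using sublinear_scaleR[OF p, of "- c" v] by simp
    then show ?thesis using odd[of "c *\<^sub>R v"] by simp
  qed (simp add: sublinear_scaleR[OF p])
qed

section \<open>Functionals dominated by the distance to a subspace\<close>

lemma infdist_lessD: "K \<noteq> {} \<Longrightarrow> infdist v K < b \<Longrightarrow> \<exists>a\<in>K. dist v a < b"
  using cInf_lessD[of "dist v ` K" b] by (auto simp: infdist_notempty)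

lemma sublinear_infdist:
  fixes K :: "'a::real_normed_vector set"
  assumes K: "subspace K"
  shows "sublinear (\<lambda>v. infdist v K)"
  unfolding sublinear_def
proof (intro conjI allI impI)
  have ne: "K \<noteq> {}" using subspace_0[OF K] by auto
  have approx: "\<exists>a\<in>K. dist v a < infdist v K + e" if "0 < e" for v and e :: real
    using that by (intro infdist_lessD[OF ne]) simp
  fix u v
  show "infdist (u + v) K \<le> infdist u K + infdist v K"
  proof (rule field_le_epsilon)
    fix e :: real assume "0 < e"
    then obtain a b where ab: "a \<in> K" "b \<in> K" "dist u a < infdist u K + e/2" "dist v b < infdist v K + e/2"
      using approx[of "e/2"] by (meson half_gt_zero)
    have "infdist (u + v) K \<le> dist (u + v) (a + b)"
      using ab K by (intro infdist_le subspace_add) auto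
    also have "\<dots> \<le> dist u a + dist v b" by (rule dist_triangle_add)
    finally show "infdist (u + v) K \<le> infdist u K + infdist v K + e" using ab by linarith
  qed
next
  have ne: "K \<noteq> {}" using subspace_0[OF K] by auto
  fix r :: real and v assume "0 \<le> r"
  show "infdist (r *\<^sub>R v) K \<le> r * infdist v K"
  proof (cases "r = 0")
    case True
    then show ?thesis using subspace_0[OF K] by simp
  next
    case False
    have "infdist (r *\<^sub>R v) K / r \<le> dist v a" if "a \<in> K" for a
    proof -
      have "infdist (r *\<^sub>R v) K \<le> dist (r *\<^sub>R v) (r *\<^sub>R a)"
        using that K by (intro infdist_le subspace_scale) auto
      also have "\<dots> = r * dist v a" using \<open>0 \<le> r\<close> by (simp add: dist_norm flip: scaleR_diff_right)
      finally show ?thesis using False \<open>0 \<le> r\<close> by (simp add: field_simps)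
    qed
    then have "infdist (r *\<^sub>R v) K / r \<le> infdist v K"
      unfolding infdist_notempty[OF ne, of v] by (intro cINF_greatest ne)
    then show ?thesis using False \<open>0 \<le> r\<close> by (simp add: field_simps)
  qed
qed

text \<open>One reduction in direction \<open>f\<close> secures the value there, and finitely many
  more produce oddness on \<open>S\<close>. Together with oddness on \<open>K\<close> this reaches
  the whole space.\<close>

lemma infdist_dominates_linear:
  fixes K :: "'a::real_normed_vector set"
  assumes K: "subspace K" and S: "finite S" "span (K \<union> S) = UNIV"
  obtains g where "linear g" "\<And>v. g v \<le> infdist v K" "g f = infdist f K"
proof -
  let ?p = "\<lambda>v. infdist v K"
  have "sublinear ?p" by (rule sublinear_infdist[OF K])
  then obtain p where p: "sublinear p" "\<And>v. p v \<le> ?p v" "p (- f) = - ?p f"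
    using sublinear_reduce[of ?p] by blast
  obtain g where g: "sublinear g" "\<And>v. g v \<le> p v" "\<And>z. z \<in> S \<Longrightarrow> g (- z) = - g z"
    using sublinear_reduce_finite[OF S(1) p(1)] by blast
  have le: "g v \<le> ?p v" for v using g(2) p(2) order_trans by blast
  \<comment> \<open>The distance vanishes on \<open>K\<close>, so it is odd there and
    \<open>g\<close> inherits this.\<close>
  have "g (- u) = - g u" if "u \<in> K" for u
    using sublinear_odd_le[OF g(1) le] that subspace_neg[OF K that] by simp
  then have "K \<union> S \<subseteq> {v. g (- v) = - g v}" using g(3) by auto
  then have "span (K \<union> S) \<subseteq> {v. g (- v) = - g v}"
    by (intro span_minimal sublinear_odd_subspace g)
  then have lin: "linear g"
    unfolding S(2) by (intro sublinear_odd_linear[OF g(1)]) blast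
  have "- g f = g (- f)" using lin by (simp add: linear_neg)
  also have "\<dots> \<le> - ?p f" using g(2)[of "- f"] p(3) by simp
  finally show ?thesis using that[OF lin le] le[of f] by (simp add: antisym)
qed

subsection \<open>Minimal systems\<close>

locale minimal_system =
  fixes F :: "complex set" and smul :: "complex \<Rightarrow> 'a::banach \<Rightarrow> 'a"
    and x :: "nat \<Rightarrow> 'a" and xs :: "nat \<Rightarrow> 'a \<Rightarrow> complex"
  assumes scalars: "scalar_structure F smul"
    and system: "fundamental_minimal_system F smul x xs"
begin

section \<open>Scalars, coordinates and projections\<close>

lemma F_cases: "F = range complex_of_real \<or> F = UNIV"
  using scalars by (simp add: scalar_structure_def scalar_field_def)

lemma of_real_in_F: "complex_of_real r \<in> F"
  using F_cases by auto

lemma mult_in_F: "a \<in> F \<Longrightarrow> b \<in> F \<Longrightarrow> a * b \<in> F"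
  using F_cases by (auto simp flip: of_real_mult)

lemma smul_of_real: "smul (complex_of_real r) v = r *\<^sub>R v"
  and smul_add_right: "c \<in> F \<Longrightarrow> smul c (v + w) = smul c v + smul c w"
  and smul_add_left: "c \<in> F \<Longrightarrow> c' \<in> F \<Longrightarrow> smul (c + c') v = smul c v + smul c' v"
  and smul_mult: "c \<in> F \<Longrightarrow> c' \<in> F \<Longrightarrow> smul (c * c') v = smul c (smul c' v)"
  and norm_smul: "c \<in> F \<Longrightarrow> norm (smul c v) = cmod c * norm v"
  using scalars by (auto simp: scalar_structure_def)

lemma smul_zero_left [simp]: "smul 0 v = 0"
  using smul_of_real[of 0 v] by simp

lemma smul_scaleR: "c \<in> F \<Longrightarrow> smul c (r *\<^sub>R v) = r *\<^sub>R smul c v"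
  using smul_mult[of c "of_real r" v] smul_mult[of "of_real r" c v]
  by (simp add: of_real_in_F smul_of_real mult.commute)

lemma closure_Fspan: "closure (Fspan F smul (range x)) = UNIV"
  and xs_dual: "xs n \<in> Fdual F smul"
  and xs_x: "xs n (x k) = (if n = k then 1 else 0)"
  using system by (auto simp: fundamental_minimal_system_def)

lemma xs_in_F [simp]: "xs n v \<in> F"
  and xs_add: "xs n (v + w) = xs n v + xs n w"
  and xs_smul: "c \<in> F \<Longrightarrow> xs n (smul c v) = c * xs n v"
  using xs_dual[of n] by (auto simp: Fdual_def)

lemma bounded_linear_xs: "bounded_linear (xs n)"
proof -
  obtain K where "\<forall>v. cmod (xs n v) \<le> K * norm v"
    using xs_dual[of n] by (auto simp: Fdual_def)
  then show ?thesis
    using xs_smul[OF of_real_in_F, of n] xs_add[of n]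
    by (intro bounded_linear_intro[where K = K]) (auto simp: smul_of_real scaleR_conv_of_real mult.commute)
qed

lemma linear_xs: "linear (xs n)"
  using bounded_linear_xs by (simp add: bounded_linear.linear)

lemma bounded_linear_coordinate: "bounded_linear (\<lambda>v. smul (xs n v) (x n))"
proof -
  obtain K where K: "\<And>v. cmod (xs n v) \<le> norm v * K"
    using bounded_linear.bounded[OF bounded_linear_xs] by blast
  show ?thesis
  proof (rule bounded_linear_intro[where K = "K * norm (x n)"])
    fix v w :: 'a and r :: real
    show "smul (xs n (v + w)) (x n) = smul (xs n v) (x n) + smul (xs n w) (x n)"
      by (simp add: xs_add smul_add_left)
    show "smul (xs n (r *\<^sub>R v)) (x n) = r *\<^sub>R smul (xs n v) (x n)"
      by (simp add: linear_scale[OF linear_xs] scaleR_conv_of_real smul_mult of_real_in_F smul_of_real)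
    show "norm (smul (xs n v) (x n)) \<le> norm v * (K * norm (x n))"
      using mult_right_mono[OF K, of "norm (x n)" v] by (simp add: norm_smul mult.assoc)
  qed
qed

lemma bounded_linear_proj: "bounded_linear (proj smul x xs A)"
  unfolding proj_def by (intro bounded_linear_sum bounded_linear_coordinate)

lemma linear_proj: "linear (proj smul x xs A)"
  using bounded_linear_proj by (simp add: bounded_linear.linear)

lemma xs_proj:
  assumes "finite A"
  shows "xs i (proj smul x xs A v) = (if i \<in> A then xs i v else 0)"
proof -
  have "xs i (proj smul x xs A v) = (\<Sum>n\<in>A. xs n v * xs i (x n))"
    unfolding proj_def by (simp add: linear_sum[OF linear_xs] xs_smul)
  also have "\<dots> = (\<Sum>n\<in>A. if n = i then xs i v else 0)"
    by (intro sum.cong) (auto simp: xs_x)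
  finally show ?thesis using assms by simp
qed

text \<open>Being fixed by \<open>proj smul x xs {..<n}\<close> is how membership in the span of the
  first \<open>n\<close> vectors is expressed throughout; all coordinates from \<open>n\<close> on
  then vanish.\<close>

lemma proj_mono_eq:
  assumes "proj smul x xs {..<n} v = v" "n \<le> m"
  shows "proj smul x xs {..<m} v = v"
proof -
  have "xs i v = 0" if "n \<le> i" for i
    using xs_proj[of "{..<n}" i v] that assms(1) by simp
  then have "proj smul x xs {..<m} v = proj smul x xs {..<n} v"
    unfolding proj_def using assms(2) by (intro sum.mono_neutral_right) auto
  then show ?thesis using assms by simp
qed

lemma Fspan_proj:
  assumes "v \<in> Fspan F smul (range x)"
  obtains n where "proj smul x xs {..<n} v = v"
proof -
  obtain N :: nat and c s where cs: "\<And>i. i < N \<Longrightarrow> c i \<in> F \<and> s i \<in> range x"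
    and v: "v = (\<Sum>i<N. smul (c i) (s i))"
    using assms unfolding Fspan_def by blast
  have "\<forall>i. \<exists>k. i < N \<longrightarrow> s i = x k" using cs by blast
  then obtain k where k: "\<And>i. i < N \<Longrightarrow> s i = x (k i)" by metis
  \<comment> \<open>A crude strict upper bound for all indices that occur.\<close>
  define n where "n = Suc (\<Sum>i<N. k i)"
  have kn: "k i < n" if "i < N" for i
    unfolding n_def using member_le_sum[of i "{..<N}" k] that by auto
  have "proj smul x xs {..<n} (smul (c i) (s i)) = smul (c i) (s i)" if "i < N" for i
  proof -
    have "proj smul x xs {..<n} (smul (c i) (s i)) = (\<Sum>m<n. if m = k i then smul (c i) (x m) else 0)"
      unfolding proj_def using cs[OF that] k[OF that] by (intro sum.cong) (auto simp: xs_smul xs_x)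
    then show ?thesis using kn[OF that] k[OF that] by simp
  qed
  then have "proj smul x xs {..<n} v = v"
    unfolding v by (simp add: linear_sum[OF linear_proj])
  then show ?thesis by (rule that)
qed

section \<open>Approximation by finitely supported vectors\<close>

lemma finite_approx:
  assumes "0 < e"
  obtains w n where "norm (v - w) < e" "proj smul x xs {..<n} w = w"
proof -
  obtain w where "w \<in> Fspan F smul (range x)" "dist w v < e"
    using closure_Fspan assms closure_approachable by blast
  then show ?thesis
    using that Fspan_proj by (metis dist_commute dist_norm)
qed

text \<open>A finitely supported approximant of \<open>u\<close> may have coordinates below
  \<open>N\<close>. Removing them with \<open>?Q\<close> does little harm, since \<open>?Q\<close>
  is continuous and fixes \<open>u\<close>.\<close>

lemma finite_approx_ker:
  assumes "0 < e" and u: "\<forall>i<N. xs i u = 0"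
  shows "\<exists>w n. norm (u - w) < e \<and> (\<forall>i. i < N \<or> n \<le> i \<longrightarrow> xs i w = 0)"
proof -
  let ?Q = "\<lambda>v. v - proj smul x xs {..<N} v"
  have "isCont ?Q u"
    by (intro continuous_intros linear_continuous_at bounded_linear_proj)
  then obtain r where r: "0 < r" "\<And>w. dist w u < r \<Longrightarrow> dist (?Q w) (?Q u) < e"
    using assms(1) unfolding continuous_at_eps_delta by blast
  obtain w n where w: "norm (u - w) < r" "proj smul x xs {..<n} w = w"
    using finite_approx[OF r(1)] by blast
  have "?Q u = u" unfolding proj_def using u by simp
  then have "norm (u - ?Q w) < e"
    using r(2)[of w] w(1) by (simp add: dist_norm norm_minus_commute)
  moreover have "xs i (?Q w) = 0" if "i < N \<or> n \<le> i" for i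
  proof (cases "i < N")
    case False
    then have "xs i w = 0" using that xs_proj[of "{..<n}" i w] w(2) by simp
    then show ?thesis by (simp add: linear_diff[OF linear_xs] xs_proj)
  qed (simp add: linear_diff[OF linear_xs] xs_proj)
  ultimately show ?thesis by blast
qed

section \<open>Duality between the dual span and joint kernels\<close>

lemma smul_Re_Im:
  assumes "F = UNIV"
  shows "smul c v = Re c *\<^sub>R v + Im c *\<^sub>R smul \<i> v"
proof -
  have "smul c v = smul (complex_of_real (Re c) + complex_of_real (Im c) * \<i>) v"
    by (metis complex_eq mult.commute)
  then show ?thesis using assms by (simp add: smul_add_left smul_mult smul_of_real)
qed

text \<open>Over the reals \<open>smul \<i> v\<close> is an unspecified vector; listing it anyway
  gives one real spanning set for both fields.\<close>

lemma smul_in_span: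
  assumes "c \<in> F"
  shows "smul c v \<in> span {v, smul \<i> v}"
proof -
  consider r where "c = complex_of_real r" | "F = UNIV" using F_cases assms by blast
  then show ?thesis
  proof cases
    case 1
    then show ?thesis by (simp add: smul_of_real span_base span_scale)
  next
    case 2
    then show ?thesis by (simp add: smul_Re_Im[of c] span_add span_base span_scale)
  qed
qed

text \<open>In the complex case, \<open>G v\<close> is \<open>g v\<close> minus \<open>\<i>\<close>
  times \<open>g (smul \<i> v)\<close>, the complex-linear functional with real part
  \<open>g\<close>.\<close>

lemma real_functional_extend:
  assumes g: "linear g"
  obtains G where "\<And>v. G v \<in> F" "\<And>v w. G (v + w) = G v + G w"
    "\<And>c v. c \<in> F \<Longrightarrow> G (smul c v) = c * G v" "\<And>v. Re (G v) = g v"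
  using F_cases
proof
  assume F: "F = range complex_of_real"
  show ?thesis
    by (rule that[of "\<lambda>v. complex_of_real (g v)"])
      (auto simp: F linear_add[OF g] linear_scale[OF g] smul_of_real)
next
  assume F: "F = UNIV"
  note smul_eq = smul_Re_Im[OF F]
  have ii: "smul \<i> (smul \<i> v) = - v" for v
    using smul_mult[of \<i> \<i> v] F smul_of_real[of "-1" v] by simp
  show ?thesis
  proof (rule that[of "\<lambda>v. Complex (g v) (- g (smul \<i> v))"])
    fix c v
    have "g (smul c v) = Re c * g v + Im c * g (smul \<i> v)"
      unfolding smul_eq[of c v] by (simp add: linear_add[OF g] linear_scale[OF g])
    moreover have "g (smul \<i> (smul c v)) = Re c * g (smul \<i> v) - Im c * g v"
      unfolding smul_eq[of c v]
      using F by (simp add: smul_add_right smul_scaleR ii linear_add[OF g] linear_diff[OF g] linear_scale[OF g])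
    ultimately show "Complex (g (smul c v)) (- g (smul \<i> (smul c v))) = c * Complex (g v) (- g (smul \<i> v))"
      by (simp add: complex_eq_iff)
  qed (auto simp: F linear_add[OF g] smul_add_right complex_eq_iff)
qed

text \<open>The distance from \<open>f\<close> to the joint kernel \<open>K\<close> is the value at
  \<open>f\<close> of a functional dominated by that distance. It kills \<open>K\<close>, hence lies
  in the dual span with norm at most 1, and the hypothesis bounds it by \<open>a\<close>, whatever
  \<open>N\<close> is.\<close>

lemma ker_approx:
  assumes a: "\<And>g. g \<in> dual_span F xs \<Longrightarrow> (\<And>v. cmod (g v) \<le> norm v) \<Longrightarrow> cmod (g f) \<le> a"
    and "a < b"
  shows "\<exists>u. (\<forall>i<N. xs i u = 0) \<and> norm (f - u) < b"
proof -
  define K where "K = {u. \<forall>i<N. xs i u = 0}"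
  define S where "S = x ` {..<N} \<union> (\<lambda>i. smul \<i> (x i)) ` {..<N}"
  let ?P = "proj smul x xs {..<N}"
  have K: "subspace K"
    unfolding K_def
    by (rule subspaceI)
      (auto simp: linear_0[OF linear_xs] linear_add[OF linear_xs] linear_scale[OF linear_xs])
  have PK: "v - ?P v \<in> K" for v
    unfolding K_def by (simp add: linear_diff[OF linear_xs] xs_proj)
  have "v \<in> span (K \<union> S)" for v
  proof -
    have "smul c (x i) \<in> span (K \<union> S)" if "c \<in> F" "i < N" for c i
      using smul_in_span[OF that(1), of "x i"] that(2) span_mono[of "{x i, smul \<i> (x i)}" "K \<union> S"]
      by (auto simp: S_def)
    then have "?P v \<in> span (K \<union> S)"
      unfolding proj_def by (intro span_sum) auto
    moreover have "v - ?P v \<in> span (K \<union> S)" using PK by (simp add: span_base)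
    ultimately show ?thesis using span_add by fastforce
  qed
  then have span: "span (K \<union> S) = UNIV" by auto
  have fin: "finite S" by (simp add: S_def)
  obtain g where g: "linear g" "\<And>v. g v \<le> infdist v K" "g f = infdist f K"
    using infdist_dominates_linear[OF K fin span, where f = f] by blast
  obtain G where G: "\<And>v. G v \<in> F" "\<And>v w. G (v + w) = G v + G w"
    "\<And>c v. c \<in> F \<Longrightarrow> G (smul c v) = c * G v" "\<And>v. Re (G v) = g v"
    using real_functional_extend[OF g(1)] by blast
  \<comment> \<open>Rotating the phase of \<open>G v\<close> to make it real and nonnegative turns
    bounds on the real part \<open>g\<close> into bounds on \<open>cmod (G v)\<close>.\<close>
  have rot: "\<exists>c\<in>F. cmod c = 1 \<and> cmod (G v) = g (smul c v)" for v
  proof -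
    define c where "c = (if G v = 0 then 1 else cnj (G v) / cmod (G v))"
    have "c \<in> F"
      using F_cases of_real_in_F[of 1] G(1)[of v] unfolding c_def by (auto simp flip: of_real_divide)
    have "c * G v = complex_of_real (cmod (G v))"
    proof (cases "G v = 0")
      case False
      then have "c * G v = (G v * cnj (G v)) / cmod (G v)" by (simp add: c_def)
      also have "\<dots> = (complex_of_real (cmod (G v)))\<^sup>2 / cmod (G v)" using complex_norm_square[of "G v"] by simp
      also have "\<dots> = cmod (G v)" using False by (simp add: power2_eq_square)
      finally show ?thesis .
    qed simp
    then have "G (smul c v) = cmod (G v)" using G(3)[OF \<open>c \<in> F\<close>] by simp
    then have "cmod (G v) = g (smul c v)" using G(4)[of "smul c v"] by simp
    moreover have "cmod c = 1" by (simp add: c_def norm_divide)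
    ultimately show ?thesis using \<open>c \<in> F\<close> by blast
  qed
  have G_le: "cmod (G v) \<le> norm v" for v
  proof -
    obtain c where c: "c \<in> F" "cmod c = 1" "cmod (G v) = g (smul c v)" using rot by blast
    have "g (smul c v) \<le> dist (smul c v) 0"
      by (rule order_trans[OF g(2) infdist_le[OF subspace_0[OF K]]])
    then show ?thesis using c by (simp add: norm_smul)
  qed
  have G_K: "G u = 0" if "u \<in> K" for u
  proof -
    obtain c where c: "c \<in> F" "cmod c = 1" "cmod (G u) = g (smul c u)" using rot by blast
    have "smul c u \<in> K" using that c(1) by (simp add: K_def xs_smul)
    then have "g (smul c u) \<le> 0" using g(2)[of "smul c u"] by simp
    then have "norm (G u) \<le> 0" using c(3) by linarith
    then show ?thesis by simp
  qed
  have "linear G"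
    using G(2) G(3)[OF of_real_in_F] by (intro linearI) (auto simp: smul_of_real scaleR_conv_of_real)
  \<comment> \<open>\<open>G\<close> factors through \<open>?P\<close> because
    \<open>v - ?P v\<close> lies in \<open>K\<close>.\<close>
  have "G v = (\<Sum>i<N. G (x i) * xs i v)" for v
  proof -
    have "G v = G (?P v)"
      using G_K[OF PK[of v]] linear_diff[OF \<open>linear G\<close>] by simp
    also have "\<dots> = (\<Sum>i<N. G (x i) * xs i v)"
      by (simp add: proj_def linear_sum[OF \<open>linear G\<close>] G(3) mult.commute)
    finally show ?thesis .
  qed
  then have "G = (\<lambda>v. \<Sum>i<N. G (x i) * xs i v)" by (rule ext)
  then have "G \<in> dual_span F xs"
    unfolding dual_span_def using G(1)
    by (intro CollectI exI[of _ "{..<N}"] exI[of _ "\<lambda>i. G (x i)"] conjI finite_lessThan ballI)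
  then have "cmod (G f) \<le> a" using G_le by (rule a)
  moreover have "infdist f K \<le> cmod (G f)"
    using g(3) G(4)[of f] complex_Re_le_cmod[of "G f"] by simp
  ultimately have "infdist f K < b" using \<open>a < b\<close> by simp
  moreover have "K \<noteq> {}" using subspace_0[OF K] by auto
  ultimately show ?thesis using infdist_lessD[of K f b] unfolding K_def dist_norm by blast
qed

section \<open>Flattening coordinates by averaging\<close>

text \<open>The \<open>M\<close> summands, each within \<open>b\<close> of \<open>f\<close>, have
  successive disjoint supports. Every coordinate comes from at most one summand, so the coordinate
  bound does not grow with \<open>M\<close>.\<close>

lemma flat_sum:
  assumes K: "\<And>i v. cmod (xs i v) \<le> K * norm v" "0 \<le> K"
    and ker: "\<And>N. \<exists>u n. norm (f - u) \<le> b \<and> (\<forall>i. i < N \<or> n \<le> i \<longrightarrow> xs i u = 0)"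
    and "0 \<le> b"
  shows "\<exists>s n. norm (real M *\<^sub>R f - s) \<le> real M * b \<and> (\<forall>i. i < N \<or> n \<le> i \<longrightarrow> xs i s = 0)
     \<and> (\<forall>i. cmod (xs i s) \<le> K * (norm f + b))"
proof (induction M)
  case 0
  show ?case
    using K(2) \<open>0 \<le> b\<close> by (intro exI[of _ 0] exI[of _ N]) (simp add: linear_0[OF linear_xs])
next
  case (Suc M)
  then obtain s n where s: "norm (real M *\<^sub>R f - s) \<le> real M * b"
    "\<And>i. i < N \<or> n \<le> i \<Longrightarrow> xs i s = 0" "\<And>i. cmod (xs i s) \<le> K * (norm f + b)"
    by blast
  \<comment> \<open>The support of the new summand starts beyond both \<open>N\<close> and the
    support of \<open>s\<close>.\<close>
  obtain u m where u: "norm (f - u) \<le> b" "\<And>i. i < max N n \<or> m \<le> i \<Longrightarrow> xs i u = 0"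
    using ker by blast
  have "norm u \<le> norm f + b"
    using norm_triangle_ineq4[of f "f - u"] u(1) by simp
  then have u_le: "cmod (xs i u) \<le> K * (norm f + b)" for i
    using K(1)[of i u] mult_left_mono[OF _ K(2)] order_trans by blast
  have "real (Suc M) *\<^sub>R f - (s + u) = (real M *\<^sub>R f - s) + (f - u)"
    by (simp add: algebra_simps)
  then have "norm (real (Suc M) *\<^sub>R f - (s + u)) \<le> real (Suc M) * b"
    using s(1) u(1) norm_triangle_ineq[of "real M *\<^sub>R f - s" "f - u"] by (simp add: algebra_simps)
  moreover have "xs i (s + u) = 0" if "i < N \<or> max n m \<le> i" for i
    using that s(2)[of i] u(2)[of i] by (auto simp: xs_add less_max_iff_disj)
  moreover have "cmod (xs i (s + u)) \<le> K * (norm f + b)" for i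
    using s(2,3)[of i] u(2)[of i] u_le[of i] by (cases "i < n") (auto simp: xs_add less_max_iff_disj)
  ultimately show ?case by blast
qed

text \<open>Dividing the sum by \<open>M\<close> keeps the distance to \<open>f\<close> at most
  \<open>b\<close> but shrinks the coordinates like \<open>1 / M\<close>.\<close>

lemma flat_average:
  assumes K: "\<And>i v. cmod (xs i v) \<le> K * norm v" "0 \<le> K"
    and ker: "\<And>N. \<exists>u n. norm (f - u) \<le> b \<and> (\<forall>i. i < N \<or> n \<le> i \<longrightarrow> xs i u = 0)"
    and "0 \<le> b" "0 < \<eta>"
  shows "\<exists>u. norm (f - u) \<le> b \<and> (\<forall>i<N. xs i u = 0) \<and> (\<forall>i. cmod (xs i u) < \<eta>)"
proof -
  obtain M :: nat where M: "K * (norm f + b) / \<eta> < real M"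
    using reals_Archimedean2 by blast
  have "0 \<le> K * (norm f + b) / \<eta>" using assms by simp
  then have "0 < real M" using M by linarith
  obtain s where s: "norm (real M *\<^sub>R f - s) \<le> real M * b"
    "\<And>i. i < N \<Longrightarrow> xs i s = 0" "\<And>i. cmod (xs i s) \<le> K * (norm f + b)"
    using flat_sum[OF K ker \<open>0 \<le> b\<close>, of M N] by blast
  let ?u = "inverse (real M) *\<^sub>R s"
  have "f - ?u = inverse (real M) *\<^sub>R (real M *\<^sub>R f - s)"
    using \<open>0 < real M\<close> by (simp add: algebra_simps)
  then have "norm (f - ?u) = norm (real M *\<^sub>R f - s) / real M"
    using \<open>0 < real M\<close> by (simp only: norm_scaleR) (simp add: divide_inverse)
  then have "norm (f - ?u) \<le> b"
    using s(1) \<open>0 < real M\<close> by (simp only: pos_divide_le_eq mult.commute)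
  moreover have "xs i ?u = 0" if "i < N" for i
    using s(2)[OF that] by (simp add: linear_scale[OF linear_xs])
  moreover have "cmod (xs i ?u) < \<eta>" for i
  proof -
    have "K * (norm f + b) < real M * \<eta>" using M \<open>0 < \<eta>\<close> by (simp add: field_simps)
    then have "cmod (xs i s) < real M * \<eta>" using s(3)[of i] by linarith
    then show ?thesis
      using \<open>0 < real M\<close> by (simp add: linear_scale[OF linear_xs] field_simps norm_divide)
  qed
  ultimately show ?thesis by blast
qed

text \<open>A small multiple of \<open>z\<close>, the sum of those \<open>x i\<close> whose
  coordinate in \<open>w\<close> is missing, fills the gaps and leaves the other coordinates
  alone.\<close>

lemma approx_nonzero_coordinates:
  assumes "proj smul x xs {..<n} w = w" "0 < e" "n \<le> m"
  shows "\<exists>y. norm (w - y) < e \<and> proj smul x xs {..<m} y = y \<and> (\<forall>i<m. xs i y \<noteq> 0)"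
proof -
  let ?P = "proj smul x xs {..<m}"
  define z where "z = (\<Sum>i<m. if xs i w = 0 then x i else 0)"
  define r where "r = e / (norm z + 1)"
  have r: "0 < r" unfolding r_def using \<open>0 < e\<close> by (simp add: add_nonneg_pos)
  have xs_z: "xs k z = (if k < m \<and> xs k w = 0 then 1 else 0)" for k
  proof -
    have "xs k z = (\<Sum>i<m. if i = k then (if xs k w = 0 then 1 else 0) else 0)"
      unfolding z_def linear_sum[OF linear_xs]
      by (intro sum.cong) (auto simp: xs_x linear_0[OF linear_xs])
    then show ?thesis by simp
  qed
  have "?P z = (\<Sum>i<m. if xs i w = 0 then x i else 0)"
    unfolding proj_def xs_z by (intro sum.cong) (use smul_of_real[of 1] in auto)
  then have "?P z = z" by (simp only: z_def)
  then have "?P (w + r *\<^sub>R z) = w + r *\<^sub>R z"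
    using proj_mono_eq[OF assms(1,3)] by (simp add: linear_add[OF linear_proj] linear_scale[OF linear_proj])
  moreover have "r * norm z < e"
    unfolding r_def using \<open>0 < e\<close> add_nonneg_pos[of "norm z" 1] by (simp add: pos_divide_less_eq)
  moreover have "xs i (w + r *\<^sub>R z) \<noteq> 0" if "i < m" for i
    using that r by (auto simp: xs_add linear_scale[OF linear_xs] xs_z)
  ultimately show ?thesis using r by (intro exI[of _ "w + r *\<^sub>R z"]) auto
qed

section \<open>Uniform bounds and uniqueness of greedy sets\<close>

text \<open>Baire is applied to sets that bound coordinates and greedy sums together. The coordinate
  bound passes to the closure and yields \<open>K\<close>; the bound on greedy sums is kept on a
  dense subset of the ball.\<close>

lemma greedy_bound:
  assumes d: "\<And>j. 0 < d j" and t: "\<And>j. 0 < t j"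
    and greedy: "\<And>f. \<exists>A :: nat \<Rightarrow> nat set. (\<forall>j. A j \<in> greedy_sets xs f (d j) (t j)) \<and>
                 bounded (range (\<lambda>j. proj smul x xs (A j) f))"
  obtains \<delta> K f0 C where "0 < \<delta>" "0 \<le> K" "\<forall>i v. cmod (xs i v) \<le> K * norm v"
    "ball f0 \<delta> \<subseteq> closure {f. \<forall>j. \<exists>A\<in>greedy_sets xs f (d j) (t j). norm (proj smul x xs A f) \<le> C}"
proof -
  define X where "X C = {f. (\<forall>i. cmod (xs i f) \<le> C) \<and>
    (\<forall>j. \<exists>A\<in>greedy_sets xs f (d j) (t j). norm (proj smul x xs A f) \<le> C)}" for C
  have "\<exists>m::nat. f \<in> X m" for f
  proof -
    obtain A :: "nat \<Rightarrow> nat set" and C1 where A: "\<And>j. A j \<in> greedy_sets xs f (d j) (t j)"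
      and C1: "\<And>j. norm (proj smul x xs (A j) f) \<le> C1"
      using greedy[of f] unfolding bounded_iff by blast
    have A0: "finite (A 0)" "card (A 0) = d 0" "is_greedy_set xs f (t 0) (A 0)"
      using A[of 0] by (auto simp: greedy_sets_def)
    then obtain n where n: "n \<in> A 0" using d[of 0] by (metis card_gt_0_iff ex_in_conv)
    \<comment> \<open>Inside the finite set \<open>A 0\<close> the sum bounds a coordinate; outside,
      greediness against the member \<open>n\<close> does.\<close>
    define C2 where "C2 = (\<Sum>i\<in>A 0. cmod (xs i f)) + cmod (xs n f) / t 0"
    have C2: "cmod (xs i f) \<le> C2" for i
    proof (cases "i \<in> A 0")
      case True
      then show ?thesis
        unfolding C2_def using A0(1) t[of 0] member_le_sum[of i "A 0" "\<lambda>i. cmod (xs i f)"]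
        by (simp add: add_increasing2)
    next
      case False
      then have "cmod (xs i f) \<le> cmod (xs n f) / t 0"
        using A0(3) n t[of 0] by (simp add: is_greedy_set_def field_simps)
      then show ?thesis unfolding C2_def by (simp add: add_increasing sum_nonneg)
    qed
    obtain m :: nat where m: "max C1 C2 < real m" using reals_Archimedean2 by blast
    have "cmod (xs i f) \<le> real m" for i
      using C2[of i] m by simp
    moreover have "norm (proj smul x xs (A j) f) \<le> real m" for j
      using C1[of j] m by simp
    ultimately show ?thesis unfolding X_def using A by blast
  qed
  then have "(\<Union>m. X (real m)) = UNIV" by auto
  then obtain m f0 \<delta> where \<delta>: "0 < \<delta>" "ball f0 \<delta> \<subseteq> closure (X (real m))"
    by (rule countable_cover_closure_ball)
  let ?C = "real m"
  have "closure (X ?C) \<subseteq> {v. cmod (xs i v) \<le> ?C}" for i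
  proof (rule closure_minimal)
    show "closed {v. cmod (xs i v) \<le> ?C}"
      by (intro closed_Collect_le continuous_intros linear_continuous_on bounded_linear_xs)
  qed (auto simp: X_def)
  then have near: "cmod (xs i v) \<le> ?C" if "dist f0 v < \<delta>" for i v
    using that \<delta>(2) by (metis in_mono mem_Collect_eq mem_ball)
  have "cmod (xs i v) \<le> 4 * ?C / \<delta> * norm v" for i v
  proof (cases "v = 0")
    case False
    \<comment> \<open>Both \<open>f0\<close> and \<open>f0 + ?r *\<^sub>R v\<close> lie in the ball,
      so their difference has coordinates at most \<open>2 * ?C\<close>.\<close>
    let ?r = "\<delta> / (2 * norm v)"
    have "cmod (xs i (f0 + ?r *\<^sub>R v)) \<le> ?C"
      using \<delta>(1) False by (intro near) (simp add: dist_norm)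
    moreover have "cmod (xs i f0) \<le> ?C" using \<delta>(1) by (intro near) simp
    moreover have "xs i (?r *\<^sub>R v) = xs i (f0 + ?r *\<^sub>R v) - xs i f0" by (simp add: xs_add)
    then have "cmod (xs i (?r *\<^sub>R v)) \<le> cmod (xs i (f0 + ?r *\<^sub>R v)) + cmod (xs i f0)"
      by (metis norm_triangle_ineq4)
    moreover have "cmod (xs i (?r *\<^sub>R v)) = ?r * cmod (xs i v)"
      using \<delta>(1) by (simp add: linear_scale[OF linear_xs])
    ultimately have "?r * cmod (xs i v) \<le> 2 * ?C" by linarith
    then show ?thesis using \<delta>(1) False by (simp add: field_simps)
  qed (simp add: linear_0[OF linear_xs])
  moreover have "X ?C \<subseteq> {f. \<forall>j. \<exists>A\<in>greedy_sets xs f (d j) (t j). norm (proj smul x xs A f) \<le> ?C}"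
    unfolding X_def by blast
  then have "ball f0 \<delta> \<subseteq> closure {f. \<forall>j. \<exists>A\<in>greedy_sets xs f (d j) (t j). norm (proj smul x xs A f) \<le> ?C}"
    using \<delta>(2) closure_mono by blast
  moreover have "0 \<le> 4 * ?C / \<delta>" using \<delta>(1) by simp
  ultimately show ?thesis using that \<delta>(1) by blast
qed

text \<open>Distinct finite sets of equal size do not contain one another; a member of
  \<open>A\<close> outside \<open>B\<close> and one of \<open>B\<close> outside \<open>A\<close>
  contradict the gap.\<close>

lemma greedy_set_unique:
  assumes A: "A \<in> greedy_sets xs f (card B) t" and "finite B"
    and gap: "\<And>n k. n \<notin> B \<Longrightarrow> k \<in> B \<Longrightarrow> cmod (xs n f) < t * cmod (xs k f)"
  shows "A = B"
proof (rule ccontr)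
  assume "A \<noteq> B"
  have A': "finite A" "card A = card B" "is_greedy_set xs f t A"
    using A by (auto simp: greedy_sets_def)
  have "\<not> A \<subseteq> B" using card_subset_eq[OF \<open>finite B\<close>, of A] A'(2) \<open>A \<noteq> B\<close> by blast
  moreover have "\<not> B \<subseteq> A" using card_subset_eq[OF A'(1), of B] A'(2) \<open>A \<noteq> B\<close> by auto
  ultimately obtain n k where "n \<in> A" "n \<notin> B" "k \<in> B" "k \<notin> A" by blast
  then have "t * cmod (xs k f) \<le> cmod (xs n f)" using A'(3) unfolding is_greedy_set_def by blast
  then show False using gap[OF \<open>n \<notin> B\<close> \<open>k \<in> B\<close>] by simp
qed

section \<open>Failure of the norming property\<close>

lemma dual_span_bounded_linear:
  assumes "g \<in> dual_span F xs"
  shows "bounded_linear g"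
proof -
  obtain A c where g: "g = (\<lambda>v. \<Sum>n\<in>A. c n * xs n v)"
    using assms by (auto simp: dual_span_def)
  show ?thesis
    unfolding g
    by (intro bounded_linear_sum bounded_linear_const_mult bounded_linear_xs)
qed

lemma dual_span_scale:
  assumes "g \<in> dual_span F xs" "a \<in> F"
  shows "(\<lambda>v. a * g v) \<in> dual_span F xs"
proof -
  obtain A c where g: "finite A" "\<forall>n\<in>A. c n \<in> F" "g = (\<lambda>v. \<Sum>n\<in>A. c n * xs n v)"
    using assms(1) by (auto simp: dual_span_def)
  have "(\<lambda>v. a * g v) = (\<lambda>v. \<Sum>n\<in>A. (a * c n) * xs n v)"
    unfolding g(3) by (simp add: sum_distrib_left mult.assoc)
  then show ?thesis
    unfolding dual_span_def using g(1,2) assms(2) mult_in_F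
    by (intro CollectI exI[of _ A] exI[of _ "\<lambda>n. a * c n"]) auto
qed

lemma onorm_scale_const:
  fixes g :: "'a \<Rightarrow> complex"
  assumes g: "bounded_linear g"
  shows "onorm (\<lambda>v. complex_of_real r * g v) = \<bar>r\<bar> * onorm g"
  using onorm_scaleR[OF g, of r] by (simp add: scaleR_conv_of_real)

text \<open>Replaces the supremum over functionals of norm exactly 1 by a bound for all functionals
  of norm at most 1, by normalising them.\<close>

lemma not_norming_witness:
  assumes "\<not> norming (dual_span F xs)" "0 < \<epsilon>" "\<epsilon> \<le> 1"
  obtains f where "f \<noteq> 0"
    "\<And>g. g \<in> dual_span F xs \<Longrightarrow> (\<And>v. cmod (g v) \<le> norm v) \<Longrightarrow> cmod (g f) \<le> \<epsilon> * norm f"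
proof -
  define S where "S f = {cmod (g f) | g. g \<in> dual_span F xs \<and> onorm g = 1}" for f
  obtain f where f: "Sup (S f) < \<epsilon> * norm f"
    using assms unfolding norming_def S_def by (meson not_le)
  have S_le: "cmod (g f) \<le> Sup (S f)" if "g \<in> dual_span F xs" "onorm g = 1" for g
  proof (rule cSup_upper)
    show "cmod (g f) \<in> S f" using that by (auto simp: S_def)
    have "cmod (h f) \<le> norm f" if "h \<in> dual_span F xs" "onorm h = 1" for h
      using onorm[OF dual_span_bounded_linear[OF that(1)], of f] that(2) by simp
    then show "bdd_above (S f)" unfolding S_def by (intro bdd_aboveI[where M = "norm f"]) auto
  qed
  have scale: "cmod (g f) \<le> onorm g * Sup (S f)" if g: "g \<in> dual_span F xs" for g
  proof (cases "onorm g = 0")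
    case True
    then have "g f = 0" using onorm[OF dual_span_bounded_linear[OF g], of f] by simp
    then show ?thesis using True by simp
  next
    case False
    then have pos: "0 < onorm g"
      using onorm_pos_le[OF dual_span_bounded_linear[OF g]] by simp
    let ?h = "\<lambda>v. complex_of_real (inverse (onorm g)) * g v"
    have "onorm ?h = 1"
      using pos by (simp only: onorm_scale_const[OF dual_span_bounded_linear[OF g]]) simp
    then have "cmod (?h f) \<le> Sup (S f)"
      using dual_span_scale[OF g of_real_in_F] by (intro S_le)
    then show ?thesis using pos by (simp add: norm_mult norm_inverse norm_divide field_simps)
  qed
  \<comment> \<open>The nonzero functional \<open>xs 0\<close> shows that the supremum is
    nonnegative, which is needed to relax \<open>onorm g = 1\<close> to
    \<open>onorm g \<le> 1\<close>.\<close>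
  have xs0: "xs 0 \<in> dual_span F xs"
    unfolding dual_span_def
    by (rule CollectI, rule exI[of _ "{0}"], rule exI[of _ "\<lambda>_. 1"]) (use of_real_in_F[of 1] in auto)
  have "0 < onorm (xs 0)"
    using onorm_pos_lt[OF bounded_linear_xs[of 0]] xs_x[of 0 0] by (metis zero_neq_one)
  then have Sup_nonneg: "0 \<le> Sup (S f)"
    using order_trans[OF norm_ge_zero scale[OF xs0]] by (simp add: zero_le_mult_iff)
  then have "f \<noteq> 0" using f by auto
  moreover have "cmod (g f) \<le> \<epsilon> * norm f"
    if "g \<in> dual_span F xs" "\<And>v. cmod (g v) \<le> norm v" for g
  proof -
    have "onorm g \<le> 1" using that(2) by (intro onorm_bound) auto
    then have "onorm g * Sup (S f) \<le> 1 * Sup (S f)" using Sup_nonneg by (rule mult_right_mono)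
    then show ?thesis using scale[OF that(1)] f by linarith
  qed
  ultimately show ?thesis by (rule that)
qed

section \<open>A vector whose greedy set is forced\<close>

lemma norming_dual_span:
  assumes d: "\<And>j. 0 < d j" "\<not> bdd_above (range d)" and t: "\<And>j. 0 < t j"
    and greedy: "\<And>f. \<exists>A :: nat \<Rightarrow> nat set. (\<forall>j. A j \<in> greedy_sets xs f (d j) (t j)) \<and>
                 bounded (range (\<lambda>j. proj smul x xs (A j) f))"
  shows "norming (dual_span F xs)"
proof (rule ccontr)
  assume not_norming: "\<not> norming (dual_span F xs)"
  obtain \<delta> K f0 C where \<delta>: "0 < \<delta>" and K0: "0 \<le> K" "\<forall>i v. cmod (xs i v) \<le> K * norm v"
    and ball: "ball f0 \<delta> \<subseteq> closure {f. \<forall>j. \<exists>A\<in>greedy_sets xs f (d j) (t j). norm (proj smul x xs A f) \<le> C}"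
    by (rule greedy_bound[OF d(1) t greedy])
  define good where "good = {f. \<forall>j. \<exists>A\<in>greedy_sets xs f (d j) (t j). norm (proj smul x xs A f) \<le> C}"
  have K: "0 \<le> K" "\<And>i v. cmod (xs i v) \<le> K * norm v" using K0 by auto
  \<comment> \<open>Large enough that any \<open>y\<close> within \<open>\<delta> / 4\<close> of
    \<open>f0 + f\<close>, where \<open>norm f = R\<close>, has norm above
    \<open>C + 1\<close>.\<close>
  define R where "R = \<bar>C\<bar> + norm f0 + \<delta> + 1"
  have R: "0 < R" unfolding R_def using \<delta> by (simp add: add_nonneg_pos)
  \<comment> \<open>Capped at 1 to be an admissible norming constant; the other term makes
    \<open>f\<close> almost invisible to the unit ball of the dual span.\<close>
  define \<epsilon> where "\<epsilon> = min 1 (\<delta> / (8 * R))"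
  have \<epsilon>: "0 < \<epsilon>" "\<epsilon> \<le> 1" "\<epsilon> * R < \<delta> / 4"
  proof -
    show "0 < \<epsilon>" "\<epsilon> \<le> 1" using \<delta> R by (auto simp: \<epsilon>_def)
    have "\<epsilon> * R \<le> \<delta> / (8 * R) * R" unfolding \<epsilon>_def using R by (intro mult_right_mono) auto
    also have "\<dots> < \<delta> / 4" using \<delta> R by simp
    finally show "\<epsilon> * R < \<delta> / 4" .
  qed
  obtain f1 where f1: "f1 \<noteq> 0"
    "\<And>g. g \<in> dual_span F xs \<Longrightarrow> (\<And>v. cmod (g v) \<le> norm v) \<Longrightarrow> cmod (g f1) \<le> \<epsilon> * norm f1"
    using not_norming_witness[OF not_norming \<epsilon>(1,2)] by blast
  define f where "f = (R / norm f1) *\<^sub>R f1"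
  have norm_f: "norm f = R" using f1(1) R by (simp add: f_def)
  have f_le: "cmod (g f) \<le> \<epsilon> * R" if "g \<in> dual_span F xs" "\<And>v. cmod (g v) \<le> norm v" for g
  proof -
    have "cmod (g f) = R / norm f1 * cmod (g f1)"
      using R linear_scale[OF bounded_linear.linear[OF dual_span_bounded_linear[OF that(1)]], of "R / norm f1" f1]
      by (simp add: f_def)
    also have "\<dots> \<le> R / norm f1 * (\<epsilon> * norm f1)"
      using f1(2)[OF that] R by (intro mult_left_mono) auto
    finally show ?thesis using f1(1) by (simp add: mult.commute)
  qed
  \<comment> \<open>One \<open>\<delta> / 4\<close> pays for reaching the joint kernel, the other
    for making the support finite.\<close>
  have ker: "\<exists>u n. norm (f - u) \<le> \<delta> / 2 \<and> (\<forall>i. i < N \<or> n \<le> i \<longrightarrow> xs i u = 0)" for N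
  proof -
    have "\<exists>u. (\<forall>i<N. xs i u = 0) \<and> norm (f - u) < \<delta> / 4"
    proof (rule ker_approx[OF _ \<epsilon>(3)])
      fix g assume "g \<in> dual_span F xs" "\<And>v. cmod (g v) \<le> norm v"
      then show "cmod (g f) \<le> \<epsilon> * R" by (rule f_le)
    qed
    then obtain u where u: "\<forall>i<N. xs i u = 0" "norm (f - u) < \<delta> / 4" by blast
    obtain w n where w: "norm (u - w) < \<delta> / 4" "\<forall>i. i < N \<or> n \<le> i \<longrightarrow> xs i w = 0"
      using finite_approx_ker[OF _ u(1), of "\<delta> / 4"] \<delta> by auto
    have "norm (f - w) \<le> norm (f - u) + norm (u - w)"
      using norm_triangle_ineq[of "f - u" "u - w"] by simp
    then show ?thesis using u(2) w by (intro exI[of _ w] exI[of _ n]) auto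
  qed
  have "0 < \<delta> / 8" using \<delta> by simp
  obtain y0 n where y0: "norm (f0 + f - y0) < \<delta> / 8" "proj smul x xs {..<n} y0 = y0"
    using finite_approx[OF \<open>0 < \<delta> / 8\<close>] .
  \<comment> \<open>Unboundedness of \<open>d\<close> makes room for the support of
    \<open>y0\<close>; filling the zero coordinates below \<open>d j\<close> then gives a support of
    size exactly \<open>d j\<close>.\<close>
  obtain j where j: "n \<le> d j"
    using d(2) unfolding bdd_above_def by (metis nle_le rangeE)
  define B where "B = {..<d j}"
  obtain y where y: "norm (y0 - y) < \<delta> / 8" "proj smul x xs B y = y" "\<And>i. i \<in> B \<Longrightarrow> xs i y \<noteq> 0"
    using approx_nonzero_coordinates[OF y0(2) \<open>0 < \<delta> / 8\<close> j] unfolding B_def by auto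
  have fy: "norm (f0 + f - y) < \<delta> / 4"
    using norm_triangle_ineq[of "f0 + f - y0" "y0 - y"] y0(1) y(1) by simp
  have y_outside: "xs i y = 0" if "i \<notin> B" for i
    using xs_proj[of B i y] that y(2) by (simp add: B_def)
  define \<eta> where "\<eta> = Min ((\<lambda>i. cmod (xs i y)) ` B)"
  have "B \<noteq> {}" "finite B" using d(1)[of j] by (auto simp: B_def)
  then have \<eta>: "0 < \<eta>" "\<And>i. i \<in> B \<Longrightarrow> \<eta> \<le> cmod (xs i y)"
    unfolding \<eta>_def using y(3) by auto
  have t\<eta>: "0 < t j * \<eta> / 2" using t[of j] \<eta>(1) by simp
  obtain u where u: "norm (f - u) \<le> \<delta> / 2" "\<And>i. i \<in> B \<Longrightarrow> xs i u = 0" "\<And>i. cmod (xs i u) < t j * \<eta> / 2"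
    using flat_average[OF K(2,1) ker _ t\<eta>, where N = "d j"] \<delta> unfolding B_def by auto
  define g where "g = y - u"
  \<comment> \<open>The summand \<open>f\<close> cancels, so \<open>g\<close> is within
    \<open>\<delta> / 4 + \<delta> / 2\<close> of \<open>f0\<close>.\<close>
  have "norm (f0 - g) \<le> norm (f0 + f - y) + norm (f - u)"
    unfolding g_def using norm_triangle_ineq4[of "f0 + f - y" "f - u"] by (simp add: algebra_simps)
  then have g_closure: "g \<in> closure good"
    using ball[folded good_def] fy u(1) \<delta> by (auto simp: dist_norm)
  have "proj smul x xs B u = 0" unfolding proj_def using u(2) by simp
  then have Pg: "proj smul x xs B g = y" unfolding g_def using y(2) by (simp add: linear_diff[OF linear_proj])
  have "isCont (proj smul x xs B) g" by (intro linear_continuous_at bounded_linear_proj)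
  then obtain r where r: "0 < r" "\<And>h. dist h g < r \<Longrightarrow> dist (proj smul x xs B h) y < 1"
    unfolding continuous_at_eps_delta Pg[symmetric] by (metis zero_less_one)
  \<comment> \<open>Chosen so that a coordinate error \<open>q\<close> satisfies
    \<open>q * (1 + t j) < \<eta> * t j / 2\<close>, which is the gap
    \<open>t j * \<eta> / 2 + q < t j * (\<eta> - q)\<close> used below. The \<open>K + 1\<close>
    avoids division by zero.\<close>
  define s where "s = \<eta> * t j / (2 * (1 + t j)) / (K + 1)"
  have pos: "0 < K + 1" "0 < 1 + t j" using K(1) t[of j] by auto
  have s: "0 < s" unfolding s_def using pos \<eta>(1) t[of j] by simp
  have "0 < min r s" using r(1) s by simp
  then obtain h where h: "h \<in> good" "dist h g < min r s"
    using g_closure unfolding closure_approachable by blast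
  define q where "q = K * norm (h - g)"
  have hg: "cmod (xs i h - xs i g) \<le> q" for i
    using K(2)[of i "h - g"] by (simp add: q_def linear_diff[OF linear_xs])
  have cancel: "(K + 1) * (a / (K + 1)) = a" for a using pos by simp
  have "q \<le> (K + 1) * norm (h - g)" unfolding q_def by (intro mult_right_mono) auto
  also have "\<dots> < (K + 1) * s" using h(2) pos by (intro mult_strict_left_mono) (auto simp: dist_norm)
  also have "\<dots> = \<eta> * t j / (2 * (1 + t j))" unfolding s_def using cancel by (simp only:)
  finally have "q < \<eta> * t j / (2 * (1 + t j))" .
  moreover have "0 < 2 * (1 + t j)" using pos by simp
  ultimately have "q * (2 * (1 + t j)) < \<eta> * t j" by (simp only: pos_less_divide_eq)
  then have q: "q * (1 + t j) < \<eta> * t j / 2" by (simp add: algebra_simps)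
  obtain A where A: "A \<in> greedy_sets xs h (d j) (t j)" "norm (proj smul x xs A h) \<le> C"
    using h(1) unfolding good_def by blast
  have "A = B"
  proof (rule greedy_set_unique)
    show "A \<in> greedy_sets xs h (card B) (t j)" using A(1) by (simp add: B_def)
    fix n k assume nk: "n \<notin> B" "k \<in> B"
    have "cmod (xs n g) < t j * \<eta> / 2"
      using u(3)[of n] y_outside[OF nk(1)] by (simp add: g_def linear_diff[OF linear_xs])
    then have n_less: "cmod (xs n h) < t j * \<eta> / 2 + q"
      using hg[of n] norm_triangle_ineq2[of "xs n h" "xs n g"] by linarith
    have "\<eta> \<le> cmod (xs k g)"
      using \<eta>(2)[OF nk(2)] u(2)[OF nk(2)] by (simp add: g_def linear_diff[OF linear_xs])
    then have "\<eta> - q \<le> cmod (xs k h)"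
      using hg[of k] norm_triangle_ineq3[of "xs k h" "xs k g"] by linarith
    then have "t j * (\<eta> - q) \<le> t j * cmod (xs k h)" using t[of j] by (intro mult_left_mono) auto
    moreover have "t j * \<eta> / 2 + q < t j * (\<eta> - q)" using q by (simp add: algebra_simps)
    ultimately show "cmod (xs n h) < t j * cmod (xs k h)" using n_less by linarith
  qed (rule \<open>finite B\<close>)
  \<comment> \<open>The greedy sum of \<open>h\<close> is now its projection onto \<open>B\<close>,
    within 1 of \<open>y\<close>.\<close>
  then have "norm y < C + 1"
    using A(2) r(2)[of h] h(2) norm_triangle_ineq2[of y "proj smul x xs B h"]
    by (simp add: dist_norm norm_minus_commute)
  moreover have "R \<le> norm f0 + norm y + \<delta> / 4"
  proof -
    have "f = (f0 + f - y) + (y - f0)" by simp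
    then have "norm f \<le> norm (f0 + f - y) + norm (y - f0)" by (metis norm_triangle_ineq)
    then show ?thesis using fy norm_f norm_triangle_ineq4[of y f0] by linarith
  qed
  ultimately show False unfolding R_def using \<delta> by linarith
qed

end

theorem theorem3p8:
  fixes F :: "complex set" and smul :: "complex \<Rightarrow> 'a::banach \<Rightarrow> 'a"
    and x :: "nat \<Rightarrow> 'a" and xs :: "nat \<Rightarrow> 'a \<Rightarrow> complex"
    and d :: "nat \<Rightarrow> nat" and t :: "nat \<Rightarrow> real"
  assumes "scalar_structure F smul"
    and "infinite_dimensional_separable TYPE('a)"
    and "fundamental_minimal_system F smul x xs"
    and "\<forall>j. 0 < d j"
    and "\<not> bdd_above (range d)"
    and "\<forall>j. 0 < t j \<and> t j < 1"
    and "\<forall>f. \<exists>A :: nat \<Rightarrow> nat set. (\<forall>j. A j \<in> greedy_sets xs f (d j) (t j)) \<and>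
                 bounded (range (\<lambda>j. proj smul x xs (A j) f))"
  shows "norming (dual_span F xs)"
proof -
  interpret minimal_system F smul x xs
    using assms(1,3) by unfold_locales
  show ?thesis
    by (rule norming_dual_span[OF spec[OF assms(4)] assms(5) conjunct1[OF spec[OF assms(6)]]
          spec[OF assms(7)]])
qed

end
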